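(* Let $T_1,T_2,T_3\in\mathcal{B}_A(\mathcal{H})$ and let $i$ denote the imaginary unit when it multiplies an operator. Then $$w_{\mathbb{A}}\left(\begin{bmatrix}T_1&T_2&T_3\\ T_2&T_3&iT_1\\ T_3&iT_1&iT_2\end{bmatrix}\right)\le w_A(T_3)+\max\{w_A(T_1),w_A(T_2)\}+\sqrt2\left(\|T_1-T_2\|_A+\|T_1+T_2\|_A\right).$$
   Context: $\mathcal{H}$ is a complex Hilbert space with inner product $\langle\cdot,\cdot\rangle$, $\mathcal{B}(\mathcal{H})$ is the algebra of bounded linear operators on $\mathcal{H}$, and $A\in\mathcal{B}(\mathcal{H})$ is a fixed positive operator ($\langle Ax,x\rangle\ge 0$ for all $x$). Put $\langle x,y\rangle_A=\langle Ax,y\rangle$ and $\|x\|_A=\sqrt{\langle x,x\rangle_A}$. $\mathcal{B}_A(\mathcal{H})$ is the set of $T\in\mathcal{B}(\mathcal{H})$ admitting an $A$-adjoint, i.e. for which there is $X\in\mathcal{B}(\mathcal{H})$ with $AX=T^*A$ (equivalently $\mathcal{R}(T^*A)\subseteq\mathcal{R}(A)$). The $A$-operator seminorm is $\|T\|_A=\sup_{x\in\overline{\mathcal{R}(A)},\,x\ne0}\|Tx\|_A/\|x\|_A$ and the $A$-numerical radius is $w_A(T)=\sup\{|\langle Tx,x\rangle_A|: x\in\mathcal{H},\ \|x\|_A=1\}$. $\mathbb{A}$ denotes the $3\times3$ block diagonal operator matrix on $\mathcal{H}\oplus\mathcal{H}\oplus\mathcal{H}$ with all diagonal entries $A$, and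 $w_{\mathbb{A}}$ is the numerical radius defined in the same way with $\mathcal{H},A$ replaced by $\mathcal{H}\oplus\mathcal{H}\oplus\mathcal{H},\mathbb{A}$. *)

theory Defs
  imports "HOL-Analysis.Analysis"
begin

class complex_vector = real_vector +
  fixes scaleC :: "complex \<Rightarrow> 'a \<Rightarrow> 'a" (infixr "*\<^sub>C" 75)
  assumes scaleC_add_right: "a *\<^sub>C (x + y) = a *\<^sub>C x + a *\<^sub>C y"
    and scaleC_add_left: "(a + b) *\<^sub>C x = a *\<^sub>C x + b *\<^sub>C x"
    and scaleC_scaleC: "a *\<^sub>C b *\<^sub>C x = (a * b) *\<^sub>C x"
    and scaleC_one: "1 *\<^sub>C x = x"
    and scaleR_scaleC: "r *\<^sub>R x = complex_of_real r *\<^sub>C x"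

text \<open>The inner product is linear in its first argument. The last axiom makes the real inner
  product its real part, so that the norm and topology inherited from \<^class>\<open>real_inner\<close> are the
  ones induced by the complex inner product; positive definiteness is inherited as well.\<close>

class complex_inner = complex_vector + real_inner +
  fixes cinner :: "'a \<Rightarrow> 'a \<Rightarrow> complex"
  assumes cinner_commute: "cinner x y = cnj (cinner y x)"
    and cinner_add_left: "cinner (x + y) z = cinner x z + cinner y z"
    and cinner_scaleC_left: "cinner (a *\<^sub>C x) y = a * cinner x y"
    and inner_eq_Re_cinner: "inner x y = Re (cinner x y)"

class chilbert_space = complex_inner + complete_space

instantiation prod :: (complex_vector, complex_vector) complex_vector
begin

definition scaleC_prod :: "complex \<Rightarrow> 'a \<times> 'b \<Rightarrow> 'a \<times> 'b"
  where "scaleC_prod a p = (a *\<^sub>C fst p, a *\<^sub>C snd p)"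

instance
  by standard
    (auto simp: scaleC_prod_def scaleC_add_right scaleC_add_left scaleC_scaleC scaleC_one
      scaleR_prod_def scaleR_scaleC)

end

instantiation prod :: (complex_inner, complex_inner) complex_inner
begin

definition cinner_prod :: "'a \<times> 'b \<Rightarrow> 'a \<times> 'b \<Rightarrow> complex"
  where "cinner_prod p q = cinner (fst p) (fst q) + cinner (snd p) (snd q)"

instance
proof
  fix x y z :: "'a \<times> 'b" and a :: complex
  show "cinner x y = cnj (cinner y x)"
    using cinner_commute[of "fst x" "fst y"] cinner_commute[of "snd x" "snd y"]
    by (simp add: cinner_prod_def)
qed (simp_all add: cinner_prod_def scaleC_prod_def cinner_add_left cinner_scaleC_left
      inner_prod_def inner_eq_Re_cinner algebra_simps)

end

instance prod :: (chilbert_space, chilbert_space) chilbert_space ..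

definition bounded_clinear :: "('a::complex_inner \<Rightarrow> 'b::complex_inner) \<Rightarrow> bool"
  where "bounded_clinear T \<longleftrightarrow> bounded_linear T \<and> (\<forall>c x. T (c *\<^sub>C x) = c *\<^sub>C T x)"

definition cadjoint :: "('a::chilbert_space \<Rightarrow> 'a) \<Rightarrow> 'a \<Rightarrow> 'a"
  where "cadjoint T =
    (THE S. bounded_clinear S \<and> (\<forall>x y. cinner (T x) y = cinner x (S y)))"

definition positive_op :: "('a::complex_inner \<Rightarrow> 'a) \<Rightarrow> bool"
  where "positive_op A \<longleftrightarrow> bounded_clinear A \<and> (\<forall>x. cinner (A x) x \<in> \<real>\<^sub>\<ge>\<^sub>0)"

definition A_inner :: "('a::complex_inner \<Rightarrow> 'a) \<Rightarrow> 'a \<Rightarrow> 'a \<Rightarrow> complex"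
  where "A_inner A x y = cinner (A x) y"

definition A_norm :: "('a::complex_inner \<Rightarrow> 'a) \<Rightarrow> 'a \<Rightarrow> real"
  where "A_norm A x = sqrt (Re (A_inner A x x))"

definition A_adjointable :: "('a::chilbert_space \<Rightarrow> 'a) \<Rightarrow> ('a \<Rightarrow> 'a) set"
  where "A_adjointable A =
    {T. bounded_clinear T \<and> (\<exists>X. bounded_clinear X \<and> A \<circ> X = cadjoint T \<circ> A)}"

text \<open>Both suprema are taken in \<open>[0, \<infinity>]\<close>: the supremum over the empty set, which occurs for
  \<open>A = 0\<close>, is \<open>0\<close>. The quotient below never has denominator \<open>0\<close>, since the \<open>A\<close>-seminorm of a
  positive \<open>A\<close> is definite on the closure of the range of \<open>A\<close>.\<close>

definition A_op_seminorm :: "('a::complex_inner \<Rightarrow> 'a) \<Rightarrow> ('a \<Rightarrow> 'a) \<Rightarrow> ennreal"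
  where "A_op_seminorm A T =
    (SUP x \<in> closure (range A) - {0}. ennreal (A_norm A (T x) / A_norm A x))"

definition A_numerical_radius :: "('a::complex_inner \<Rightarrow> 'a) \<Rightarrow> ('a \<Rightarrow> 'a) \<Rightarrow> ennreal"
  where "A_numerical_radius A T =
    (SUP x \<in> {x. A_norm A x = 1}. ennreal (cmod (A_inner A (T x) x)))"

text \<open>The arguments are the block entries, row by row.\<close>

definition block_op3 ::
  "('a::complex_inner \<Rightarrow> 'a) \<Rightarrow> ('a \<Rightarrow> 'a) \<Rightarrow> ('a \<Rightarrow> 'a) \<Rightarrow>
   ('a \<Rightarrow> 'a) \<Rightarrow> ('a \<Rightarrow> 'a) \<Rightarrow> ('a \<Rightarrow> 'a) \<Rightarrow>
   ('a \<Rightarrow> 'a) \<Rightarrow> ('a \<Rightarrow> 'a) \<Rightarrow> ('a \<Rightarrow> 'a) \<Rightarrow>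
   'a \<times> 'a \<times> 'a \<Rightarrow> 'a \<times> 'a \<times> 'a"
  where "block_op3 B11 B12 B13 B21 B22 B23 B31 B32 B33 = (\<lambda>(x, y, z).
    (B11 x + B12 y + B13 z,
     B21 x + B22 y + B23 z,
     B31 x + B32 y + B33 z))"

definition diag_op3 ::
  "('a::complex_inner \<Rightarrow> 'a) \<Rightarrow> 'a \<times> 'a \<times> 'a \<Rightarrow> 'a \<times> 'a \<times> 'a"
  where "diag_op3 A = block_op3
    A (\<lambda>_. 0) (\<lambda>_. 0)
    (\<lambda>_. 0) A (\<lambda>_. 0)
    (\<lambda>_. 0) (\<lambda>_. 0) A"

end

theory Submission
  imports Defs
begin

text \<open>
  Fix \<open>(x, y, z)\<close> with \<open>\<parallel>x\<parallel>\<^sub>A\<^sup>2 + \<parallel>y\<parallel>\<^sub>A\<^sup>2 + \<parallel>z\<parallel>\<^sub>A\<^sup>2 = 1\<close> and split the quadratic form of the block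
  operator at this vector into three parts.

  \<^item> The entries \<open>T\<^sub>3\<close> lie on the antidiagonal. In the coordinates \<open>x + z\<close>, \<open>y\<close>, \<open>x - z\<close> (up to
    scaling) they become diagonal with entries \<open>T\<^sub>3\<close>, \<open>T\<^sub>3\<close>, \<open>-T\<^sub>3\<close>, so this part is at most
    \<open>w\<^sub>A(T\<^sub>3)\<close> (\<open>A_inner_swap_le\<close>).
  \<^item> The remaining diagonal is \<open>T\<^sub>1\<close>, \<open>0\<close>, \<open>\<i>T\<^sub>2\<close>, which contributes at most
    \<open>max {w\<^sub>A(T\<^sub>1), w\<^sub>A(T\<^sub>2)}\<close> (\<open>A_inner_image_le\<close>).
  \<^item> The remaining four entries pair \<open>y\<close> with \<open>x\<close> through \<open>T\<^sub>2\<close> and \<open>y\<close> with \<open>z\<close> through \<open>\<i>T\<^sub>1\<close>.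
    Writing \<open>2T\<^sub>1\<close> and \<open>2T\<^sub>2\<close> as the sum and the difference of \<open>T\<^sub>1 + T\<^sub>2\<close> and \<open>T\<^sub>1 - T\<^sub>2\<close>, each
    pairing is at most half of \<open>N = \<parallel>T\<^sub>1 - T\<^sub>2\<parallel>\<^sub>A + \<parallel>T\<^sub>1 + T\<^sub>2\<parallel>\<^sub>A\<close> times the product of the two
    seminorms, and
    \<open>N (\<parallel>x\<parallel>\<^sub>A\<parallel>y\<parallel>\<^sub>A + \<parallel>y\<parallel>\<^sub>A\<parallel>z\<parallel>\<^sub>A) \<le> N \<le> \<surd>2 N\<close> by the inequality of arithmetic and geometric means.

  The last part needs \<open>\<parallel>Tx\<parallel>\<^sub>A \<le> \<parallel>T\<parallel>\<^sub>A \<parallel>x\<parallel>\<^sub>A\<close> for every \<open>x\<close>, whereas the supremum defining \<open>\<parallel>T\<parallel>\<^sub>A\<close>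
  runs over the closure of the range of \<open>A\<close> only. Projecting orthogonally onto this closure
  changes \<open>x\<close> by an element of the kernel of \<open>A\<close>; such elements have seminorm \<open>0\<close>, and an operator
  with an \<open>A\<close>-adjoint maps the kernel of \<open>A\<close> into itself (\<open>A_norm_image_le\<close>). The projection theorem
  also gives the Riesz representation, which is what makes \<^const>\<open>cadjoint\<close> satisfy the
  adjoint identity (\<open>cinner_cadjoint\<close>).
\<close>

section \<open>Orthogonal projection and Riesz representation\<close>

text \<open>The projection is the point of \<open>S\<close> nearest to \<open>x\<close>. By the parallelogram law a minimising
  sequence is Cauchy, since the midpoint of two nearly optimal points cannot beat the infimum;
  minimality along the lines through the limit then forces orthogonality.\<close>

lemma orthogonal_projection_exists:
  fixes S :: "'a::{real_inner,complete_space} set"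
  assumes S: "subspace S" "closed S"
  obtains p where "p \<in> S" "\<And>v. v \<in> S \<Longrightarrow> inner (x - p) v = 0"
proof -
  define D where "D = (INF s\<in>S. (norm (x - s))\<^sup>2)"
  have bdd: "bdd_below ((\<lambda>s. (norm (x - s))\<^sup>2) ` S)"
    by (intro bdd_belowI[of _ 0]) auto
  have ne: "S \<noteq> {}" using S(1) subspace_0 by blast
  have D_le: "D \<le> (norm (x - s))\<^sup>2" if "s \<in> S" for s
    unfolding D_def using bdd that by (rule cINF_lower)
  have "\<exists>s\<in>S. (norm (x - s))\<^sup>2 < D + 1 / real (Suc n)" for n
    using cINF_less_iff[OF ne bdd, of "D + 1 / real (Suc n)"] by (simp add: D_def)
  then obtain s where s: "\<And>n. s n \<in> S" "\<And>n. (norm (x - s n))\<^sup>2 < D + 1 / real (Suc n)"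
    by metis
  have gap: "(dist (s m) (s n))\<^sup>2 \<le> 2 / real (Suc m) + 2 / real (Suc n)" for m n
  proof -
    let ?c = "(1/2) *\<^sub>R (s m + s n)"
    have "?c \<in> S" using s(1) S(1) by (intro subspace_mul subspace_add)
    then have c: "D \<le> (norm (x - ?c))\<^sup>2" by (rule D_le)
    have "(dist (s m) (s n))\<^sup>2 =
        2 * (norm (x - s m))\<^sup>2 + 2 * (norm (x - s n))\<^sup>2 - 4 * (norm (x - ?c))\<^sup>2"
      unfolding dist_norm power2_norm_eq_inner
      by (simp add: inner_diff_left inner_diff_right inner_add_left inner_add_right
          inner_commute algebra_simps)
    then show ?thesis using c s(2)[of m] s(2)[of n] by argo
  qed
  have "Cauchy s"
  proof (rule metric_CauchyI)
    fix e :: real assume "e > 0"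
    then obtain N where N: "1 / real (Suc N) < e\<^sup>2 / 4"
      by (metis nat_approx_posE zero_less_divide_iff zero_less_numeral zero_less_power)
    have "dist (s m) (s n) < e" if "m \<ge> N" "n \<ge> N" for m n
    proof -
      have "1 / real (Suc m) \<le> 1 / real (Suc N)" "1 / real (Suc n) \<le> 1 / real (Suc N)"
        using that by (auto intro!: divide_left_mono)
      then have "(dist (s m) (s n))\<^sup>2 < e\<^sup>2" using gap[of m n] N by argo
      then show ?thesis using \<open>e > 0\<close> power2_less_imp_less by force
    qed
    then show "\<exists>M. \<forall>m\<ge>M. \<forall>n\<ge>M. dist (s m) (s n) < e" by blast
  qed
  then obtain p where p: "s \<longlonglongrightarrow> p"
    using Cauchy_convergent convergent_def by blast
  have pS: "p \<in> S" using S(2) s(1) p by (rule closed_sequentially)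
  have "(\<lambda>n. (norm (x - s n))\<^sup>2) \<longlonglongrightarrow> (norm (x - p))\<^sup>2"
    by (intro tendsto_intros p)
  moreover have "(\<lambda>n. D + 1 / real (Suc n)) \<longlonglongrightarrow> D + 0"
    by (intro tendsto_intros) (rule LIMSEQ_Suc[OF lim_1_over_n])
  ultimately have pD: "(norm (x - p))\<^sup>2 \<le> D"
    using s(2) by (intro LIMSEQ_le) (auto intro: less_imp_le)
  show thesis
  proof (rule that[OF pS])
    fix v assume v: "v \<in> S"
    \<comment> \<open>The value of \<open>t\<close> for which \<open>p + t v\<close> is nearest to \<open>x\<close>.\<close>
    define t where "t = inner (x - p) v / inner v v"
    have "p + t *\<^sub>R v \<in> S" using S(1) pS v by (intro subspace_add subspace_mul)
    then have "(norm (x - p))\<^sup>2 \<le> (norm (x - (p + t *\<^sub>R v)))\<^sup>2"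
      using pD D_le order_trans by blast
    also have "\<dots> = (norm (x - p))\<^sup>2 - 2 * t * inner (x - p) v + t * t * inner v v"
      unfolding power2_norm_eq_inner
      by (simp add: inner_diff_left inner_diff_right inner_add_left inner_add_right
          inner_commute algebra_simps)
    finally have *: "2 * t * inner (x - p) v \<le> t * t * inner v v" by simp
    show "inner (x - p) v = 0"
    proof (cases "v = 0")
      case True
      show ?thesis unfolding True by simp
    next
      case False
      then have iv: "inner v v > 0" by simp
      then have "t * t * inner v v = t * inner (x - p) v" by (simp add: t_def)
      with * have "t * inner (x - p) v \<le> 0" by simp
      then have "(inner (x - p) v)\<^sup>2 \<le> 0"
        using iv by (simp add: t_def power2_eq_square divide_le_0_iff)
      then show ?thesis by simp
    qed
  qed
qed

text \<open>The kernel of a nonzero functional is a hyperplane, so a vector orthogonal to the kernel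
  represents the functional after scaling.\<close>

lemma Riesz_representation:
  fixes g :: "'a::{real_inner,complete_space} \<Rightarrow> real"
  assumes g: "bounded_linear g"
  obtains s where "\<And>y. g y = inner y s"
proof (cases "\<forall>y. g y = 0")
  case True
  then show ?thesis using that[of 0] by simp
next
  case False
  interpret g: bounded_linear g by (rule g)
  obtain x where x: "g x \<noteq> 0" using False by blast
  have "subspace {y. g y = 0}"
    by (auto simp: subspace_def g.zero g.add g.scaleR)
  moreover have "closed {y. g y = 0}"
    by (intro closed_Collect_eq continuous_on_const g.continuous_on continuous_on_id)
  ultimately obtain p where p: "g p = 0" "\<And>v. g v = 0 \<Longrightarrow> inner (x - p) v = 0"
    using orthogonal_projection_exists[of "{y. g y = 0}" x] by auto
  let ?u = "x - p"
  have gu: "g ?u \<noteq> 0" using x p(1) by (simp add: g.diff)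
  then have u: "inner ?u ?u \<noteq> 0" using g.zero by fastforce
  have "g y = inner y ((g ?u / inner ?u ?u) *\<^sub>R ?u)" for y
  proof -
    have "g (y - (g y / g ?u) *\<^sub>R ?u) = 0"
      using gu by (simp add: g.diff g.scaleR)
    from p(2)[OF this] have "inner ?u y = (g y / g ?u) * inner ?u ?u"
      by (simp only: inner_diff_right inner_scaleR_right right_minus_eq)
    then have "g y = (g ?u / inner ?u ?u) * inner ?u y" using gu u by simp
    then show ?thesis by (simp only: inner_scaleR_right inner_commute[of y])
  qed
  then show ?thesis by (rule that)
qed

lemma subspace_closure:
  fixes S :: "'a::real_normed_vector set"
  assumes S: "subspace S"
  shows "subspace (closure S)"
proof (rule subspaceI)
  show "0 \<in> closure S" using S subspace_0 closure_subset by blast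
next
  fix x y assume "x \<in> closure S" "y \<in> closure S"
  then obtain f g where "\<And>n. f n \<in> S" "f \<longlonglongrightarrow> x" "\<And>n. g n \<in> S" "g \<longlonglongrightarrow> y"
    unfolding closure_sequential by blast
  then show "x + y \<in> closure S"
    unfolding closure_sequential
    by (intro exI[of _ "\<lambda>n. f n + g n"]) (auto intro: tendsto_add subspace_add[OF S])
next
  fix x and c :: real assume "x \<in> closure S"
  then obtain f where "\<And>n. f n \<in> S" "f \<longlonglongrightarrow> x"
    unfolding closure_sequential by blast
  then show "c *\<^sub>R x \<in> closure S"
    unfolding closure_sequential
    by (intro exI[of _ "\<lambda>n. c *\<^sub>R f n"]) (auto intro: tendsto_intros subspace_mul[OF S])
qed

section \<open>Complex inner products and adjoints\<close>

text \<open>This recovers the complex inner product from the real one, so that adjoint identities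
  for the real inner product carry over to the complex one.\<close>

lemma cinner_eq_inner:
  "cinner x y = Complex (inner x y) (- inner (\<i> *\<^sub>C x) y)"
  by (rule complex_eqI) (simp_all add: inner_eq_Re_cinner cinner_scaleC_left)

lemma cinner_add_right: "cinner x (y + z) = cinner x y + cinner x z"
  by (metis cinner_add_left cinner_commute complex_cnj_add)

lemma cinner_scaleC_right: "cinner x (a *\<^sub>C y) = cnj a * cinner x y"
  by (metis cinner_scaleC_left cinner_commute complex_cnj_mult)

lemma cinner_diff_left: "cinner (x - y) z = cinner x z - cinner y z"
  by (metis add_diff_cancel_right' cinner_add_left diff_add_cancel)

lemma cinner_diff_right: "cinner x (y - z) = cinner x y - cinner x z"
  by (metis add_diff_cancel_right' cinner_add_right diff_add_cancel)

lemma scaleC_diff_right: "c *\<^sub>C (x - y) = c *\<^sub>C x - c *\<^sub>C y"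
  for x y :: "'a::complex_vector"
  by (metis add_diff_cancel_right' diff_add_cancel scaleC_add_right)

lemma cinner_zero_left [simp]: "cinner 0 y = 0"
  using cinner_add_left[of 0 0 y] by simp

lemma bounded_clinearD:
  assumes "bounded_clinear T"
  shows "bounded_linear T" "T (c *\<^sub>C x) = c *\<^sub>C T x" "T (x + y) = T x + T y"
    "T (x - y) = T x - T y" "T 0 = 0"
proof -
  show T: "bounded_linear T" and "T (c *\<^sub>C x) = c *\<^sub>C T x"
    using assms by (auto simp: bounded_clinear_def)
  interpret bounded_linear T by (rule T)
  show "T (x + y) = T x + T y" "T (x - y) = T x - T y" "T 0 = 0"
    by (simp_all add: add diff zero)
qed

text \<open>The definite description in the definition of \<^const>\<open>cadjoint\<close> denotes: for fixed \<open>y\<close> the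
  functional \<open>x \<mapsto> inner (T x) y\<close> is represented by a vector \<open>S y\<close>, and linearity of \<open>S\<close> follows from
  uniqueness of this vector.\<close>

lemma cinner_cadjoint:
  fixes T :: "'a::chilbert_space \<Rightarrow> 'a"
  assumes T: "bounded_clinear T"
  shows "cinner (T x) y = cinner x (cadjoint T y)"
proof -
  note Tl = bounded_clinearD[OF T]
  have "\<exists>s. \<forall>x. inner (T x) y = inner x s" for y
  proof -
    have "bounded_linear (\<lambda>x. inner (T x) y)"
      using bounded_linear_compose[OF bounded_linear_inner_left Tl(1)] .
    then show ?thesis using Riesz_representation by metis
  qed
  then obtain S where S: "\<And>x y. inner (T x) y = inner x (S y)" by metis
  have cS: "cinner (T x) y = cinner x (S y)" for x y
    using S[of x y] S[of "\<i> *\<^sub>C x" y] by (simp add: cinner_eq_inner Tl(2))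
  have unique: "u = v" if "\<And>x. cinner x u = cinner x v" for u v :: 'a
  proof -
    have "inner (u - v) (u - v) = 0"
      using that[of "u - v"] by (simp add: inner_eq_Re_cinner cinner_diff_right)
    then show ?thesis by simp
  qed
  have "bounded_linear S"
  proof -
    obtain K where K: "K > 0" "\<And>x. norm (T x) \<le> norm x * K"
      using bounded_linear.pos_bounded[OF Tl(1)] by blast
    show ?thesis
    proof (rule bounded_linear_intro[where K = K])
      fix x y show "S (x + y) = S x + S y"
        by (rule unique) (simp add: cinner_add_right flip: cS)
    next
      fix r x show "S (r *\<^sub>R x) = r *\<^sub>R S x"
        by (rule unique) (simp add: cinner_scaleC_right scaleR_scaleC flip: cS)
    next
      fix y
      have "norm (S y) * norm (S y) = inner (T (S y)) y"
        by (simp add: S power2_norm_eq_inner[symmetric] power2_eq_square)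
      also have "\<dots> \<le> norm (T (S y)) * norm y" by (rule norm_cauchy_schwarz)
      also have "\<dots> \<le> norm (S y) * K * norm y" by (intro mult_right_mono K) auto
      finally have "norm (S y) * norm (S y) \<le> norm (S y) * K * norm y" .
      then show "norm (S y) \<le> norm y * K"
      proof (cases "norm (S y) = 0")
        case False
        then have "norm (S y) > 0" by simp
        moreover have "norm (S y) * norm (S y) \<le> norm (S y) * (norm y * K)"
          using \<open>norm (S y) * norm (S y) \<le> norm (S y) * K * norm y\<close> by (simp add: ac_simps)
        ultimately show ?thesis by (rule mult_left_le_imp_le[rotated])
      qed (use K(1) in simp)
    qed
  qed
  moreover have "S (c *\<^sub>C y) = c *\<^sub>C S y" for c y
    by (rule unique) (simp add: cinner_scaleC_right flip: cS)
  ultimately have spec: "bounded_clinear S \<and> (\<forall>x y. cinner (T x) y = cinner x (S y))"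
    using cS by (simp add: bounded_clinear_def)
  have "cadjoint T = S"
    unfolding cadjoint_def
  proof (rule the_equality)
    show "bounded_clinear S \<and> (\<forall>x y. cinner (T x) y = cinner x (S y))" by (rule spec)
  next
    fix S' assume "bounded_clinear S' \<and> (\<forall>x y. cinner (T x) y = cinner x (S' y))"
    then show "S' = S" by (intro ext unique) (metis cS)
  qed
  then show ?thesis using cS by simp
qed

section \<open>The semi-inner product of a positive operator\<close>

locale positive_operator =
  fixes A :: "'a::chilbert_space \<Rightarrow> 'a"
  assumes positive: "positive_op A"
begin

lemma bounded_clinear_A: "bounded_clinear A"
  using positive by (simp add: positive_op_def)

lemmas A_linear = bounded_clinearD[OF bounded_clinear_A]

lemma A_inner_linear:
  "A_inner A (x + y) z = A_inner A x z + A_inner A y z"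
  "A_inner A (x - y) z = A_inner A x z - A_inner A y z"
  "A_inner A x (y + z) = A_inner A x y + A_inner A x z"
  "A_inner A x (y - z) = A_inner A x y - A_inner A x z"
  "A_inner A (c *\<^sub>C x) y = c * A_inner A x y"
  "A_inner A x (c *\<^sub>C y) = cnj c * A_inner A x y"
  by (simp_all add: A_inner_def A_linear cinner_add_left cinner_diff_left cinner_add_right
      cinner_diff_right cinner_scaleC_left cinner_scaleC_right)

lemma A_inner_self: "Im (A_inner A x x) = 0" "Re (A_inner A x x) \<ge> 0"
  using positive by (auto simp: positive_op_def A_inner_def complex_nonneg_Reals_iff)

text \<open>Positivity makes \<open>\<langle>v, v\<rangle>\<^sub>A\<close> real for every \<open>v\<close>. Taking \<open>v = x + y\<close> gives equality of the imaginary
  parts, and \<open>v = x + \<i>y\<close> gives equality of the real parts.\<close>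

lemma A_inner_commute: "A_inner A y x = cnj (A_inner A x y)"
proof (rule complex_eqI)
  have "Im (A_inner A (x + y) (x + y)) = 0" by (rule A_inner_self)
  then show "Im (A_inner A y x) = Im (cnj (A_inner A x y))"
    by (simp add: A_inner_linear A_inner_self)
  have "Im (A_inner A (x + \<i> *\<^sub>C y) (x + \<i> *\<^sub>C y)) = 0" by (rule A_inner_self)
  then show "Re (A_inner A y x) = Re (cnj (A_inner A x y))"
    by (simp add: A_inner_linear A_inner_self)
qed

lemma cinner_A_right: "cinner x (A y) = cinner (A x) y"
  using A_inner_commute[of x y] cinner_commute[of x "A y"] by (simp add: A_inner_def)

lemma A_norm_nonneg: "A_norm A x \<ge> 0"
  by (simp add: A_norm_def A_inner_self)

lemma A_norm_sq: "(A_norm A x)\<^sup>2 = Re (A_inner A x x)"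
  by (simp add: A_norm_def A_inner_self)

lemma A_norm_scaleC: "A_norm A (c *\<^sub>C x) = cmod c * A_norm A x"
proof -
  have "A_inner A (c *\<^sub>C x) (c *\<^sub>C x) = of_real ((cmod c)\<^sup>2) * A_inner A x x"
    by (simp add: A_inner_linear complex_norm_square mult.assoc mult.left_commute del: of_real_power)
  then show ?thesis
    by (simp add: A_norm_def real_sqrt_mult A_inner_self del: of_real_power)
qed

lemma A_norm_parallelogram:
  "(A_norm A (x + y))\<^sup>2 + (A_norm A (x - y))\<^sup>2 = 2 * (A_norm A x)\<^sup>2 + 2 * (A_norm A y)\<^sup>2"
  by (simp add: A_norm_sq A_inner_linear)

text \<open>The usual discriminant argument for \<open>\<parallel>s x - t y\<parallel>\<^sub>A\<^sup>2 \<ge> 0\<close>. Since the form may be degenerate, the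
  cases where one of the seminorms vanishes are treated separately, with \<open>s\<close> or \<open>t\<close> chosen so
  large that the cross term dominates.\<close>

lemma Re_A_inner_le: "Re (A_inner A x y) \<le> A_norm A x * A_norm A y"
proof -
  let ?a = "A_norm A x" and ?b = "A_norm A y" and ?r = "Re (A_inner A x y)"
  have *: "0 \<le> s\<^sup>2 * ?a\<^sup>2 - 2 * s * t * ?r + t\<^sup>2 * ?b\<^sup>2" for s t :: real
  proof -
    have "(A_norm A (of_real s *\<^sub>C x - of_real t *\<^sub>C y))\<^sup>2
        = s\<^sup>2 * ?a\<^sup>2 - 2 * s * t * ?r + t\<^sup>2 * ?b\<^sup>2"
      unfolding A_norm_sq
      by (simp add: A_inner_linear A_inner_commute[of y x] power2_eq_square algebra_simps)
    then show ?thesis by (metis zero_le_power2)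
  qed
  show ?thesis
  proof (rule ccontr)
    assume neg: "\<not> ?thesis"
    have a: "?a \<ge> 0" and b: "?b \<ge> 0" by (rule A_norm_nonneg)+
    have r: "?r > 0" using neg mult_nonneg_nonneg[OF a b] by linarith
    consider "?a = 0" | "?b = 0" | "?a * ?b > 0"
      using a b by (metis less_le mult_pos_pos)
    then show False
    proof cases
      case 1
      then show False
        using *[of "(?b\<^sup>2 + 1) / ?r" 1] r zero_le_power2[of ?b] by simp
    next
      case 2
      then show False
        using *[of 1 "(?a\<^sup>2 + 1) / ?r"] r zero_le_power2[of ?a] by simp
    next
      case 3
      have "?a * ?b * ?r \<le> ?a * ?b * (?a * ?b)"
        using *[of ?b ?a] by (simp add: power2_eq_square ac_simps)
      then have "?r \<le> ?a * ?b" using 3 by (rule mult_left_le_imp_le)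
      then show False using neg by simp
    qed
  qed
qed

text \<open>Multiplying \<open>x\<close> by a unimodular scalar makes \<open>\<langle>x, y\<rangle>\<^sub>A\<close> real and nonnegative.\<close>

lemma A_Cauchy_Schwarz: "cmod (A_inner A x y) \<le> A_norm A x * A_norm A y"
proof (cases "A_inner A x y = 0")
  case True
  then show ?thesis by (simp add: A_norm_nonneg)
next
  case False
  define c where "c = cnj (sgn (A_inner A x y))"
  have c: "cmod c = 1" using False by (simp add: c_def norm_sgn)
  have "A_inner A x y = of_real (cmod (A_inner A x y)) * sgn (A_inner A x y)"
    using False by (simp add: sgn_eq)
  moreover have "c * sgn (A_inner A x y) = 1"
    using c complex_norm_square[of c] by (simp add: c_def)
  ultimately have "c * A_inner A x y = of_real (cmod (A_inner A x y))"
    by (metis mult.left_commute mult.right_neutral)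
  then have "cmod (A_inner A x y) = Re (A_inner A (c *\<^sub>C x) y)"
    by (simp add: A_inner_linear)
  also have "\<dots> \<le> A_norm A (c *\<^sub>C x) * A_norm A y" by (rule Re_A_inner_le)
  finally show ?thesis using c by (simp add: A_norm_scaleC)
qed

lemma A_norm_eq_0_iff: "A_norm A x = 0 \<longleftrightarrow> A x = 0"
proof
  assume "A_norm A x = 0"
  then have "A_inner A x (A x) = 0" using A_Cauchy_Schwarz[of x "A x"] by simp
  then have "inner (A x) (A x) = 0" by (simp add: A_inner_def inner_eq_Re_cinner)
  then show "A x = 0" by simp
qed (simp add: A_norm_def A_inner_def)

lemma A_norm_add_ker: "A_norm A (x + k) = A_norm A x" if "A k = 0"
  using A_inner_commute[of k x] that by (simp add: A_norm_def A_inner_linear) (simp add: A_inner_def)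

section \<open>Operators with an A-adjoint\<close>

text \<open>With \<open>A X = T\<^sup>* A\<close> one has \<open>\<langle>A T x, y\<rangle> = \<langle>x, T\<^sup>* A y\<rangle> = \<langle>A x, X y\<rangle>\<close>, which vanishes for all \<open>y\<close>
  when \<open>A x = 0\<close>.\<close>

lemma A_adjointable_ker:
  assumes "T \<in> A_adjointable A" "A x = 0"
  shows "A (T x) = 0"
proof -
  obtain X where T: "bounded_clinear T" and X: "\<And>y. A (X y) = cadjoint T (A y)"
    using assms(1) by (auto simp: A_adjointable_def fun_eq_iff)
  let ?y = "A (T x)"
  have "cinner ?y ?y = cinner (T x) (A ?y)" by (simp add: cinner_A_right)
  also have "\<dots> = cinner x (A (X ?y))" by (simp add: cinner_cadjoint[OF T] X)
  also have "\<dots> = 0" by (simp add: cinner_A_right assms(2))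
  finally have "inner ?y ?y = 0" by (simp add: inner_eq_Re_cinner)
  then show ?thesis by simp
qed

text \<open>A vector orthogonal to the range of the self-adjoint operator \<open>A\<close> is killed by \<open>A\<close>.\<close>

lemma range_ker_decomposition:
  obtains p k where "x = p + k" "p \<in> closure (range A)" "A k = 0"
proof -
  have "subspace (range A)"
    by (intro linear_subspace_image bounded_linear.linear A_linear(1) subspace_UNIV)
  then have "subspace (closure (range A))" by (rule subspace_closure)
  then obtain p where p: "p \<in> closure (range A)" 
      "\<And>v. v \<in> closure (range A) \<Longrightarrow> inner (x - p) v = 0"
    using orthogonal_projection_exists closed_closure by blast
  have "inner (x - p) (A (A (x - p))) = 0"
    by (intro p(2) closure_subset[THEN subsetD] rangeI)
  then have "inner (A (x - p)) (A (x - p)) = 0"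
    by (simp add: inner_eq_Re_cinner cinner_A_right)
  then have "A (x - p) = 0" by simp
  then show thesis using that[of p "x - p"] p(1) by simp
qed

text \<open>Replacing \<open>x\<close> by its component in the closure of the range of \<open>A\<close> changes neither side. The
  hypothesis on \<open>T\<close> is invariance of the kernel of \<open>A\<close>, which passes to sums and differences of
  operators at once.\<close>

lemma A_norm_image_le:
  assumes T: "bounded_clinear T" and ker: "\<And>x. A x = 0 \<Longrightarrow> A (T x) = 0"
    and m: "A_op_seminorm A T = ennreal m" "m \<ge> 0"
  shows "A_norm A (T x) \<le> m * A_norm A x"
proof (cases "A x = 0")
  case True
  then have "A_norm A x = 0" "A_norm A (T x) = 0" using ker by (simp_all add: A_norm_eq_0_iff)
  then show ?thesis by simp
next
  case False
  obtain p k where pk: "x = p + k" "p \<in> closure (range A)" "A k = 0"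
    by (rule range_ker_decomposition)
  have "A p \<noteq> 0" using False pk by (simp add: A_linear)
  then have "p \<noteq> 0" and pos: "A_norm A p > 0"
    using A_linear(5) A_norm_nonneg[of p] A_norm_eq_0_iff[of p] by auto
  have "ennreal (A_norm A (T p) / A_norm A p) \<le> ennreal m"
    unfolding m(1)[symmetric] A_op_seminorm_def using pk \<open>p \<noteq> 0\<close> by (intro SUP_upper) auto
  then have "A_norm A (T p) \<le> m * A_norm A p"
    using pos m(2) by (simp add: field_simps)
  then show ?thesis
    using pk ker by (simp add: bounded_clinearD[OF T] A_norm_add_ker)
qed

lemma A_inner_image_le:
  assumes T: "bounded_clinear T" and w: "A_numerical_radius A T = ennreal w" "w \<ge> 0"
  shows "cmod (A_inner A (T x) x) \<le> w * (A_norm A x)\<^sup>2"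
proof (cases "A_norm A x = 0")
  case True
  then show ?thesis using A_Cauchy_Schwarz[of "T x" x] by simp
next
  case False
  then have pos: "A_norm A x > 0" using A_norm_nonneg[of x] by simp
  let ?c = "complex_of_real (1 / A_norm A x)"
  have "A_norm A (?c *\<^sub>C x) = 1"
    unfolding A_norm_scaleC using pos by (simp add: norm_divide)
  then have "ennreal (cmod (A_inner A (T (?c *\<^sub>C x)) (?c *\<^sub>C x))) \<le> ennreal w"
    unfolding w(1)[symmetric] A_numerical_radius_def by (intro SUP_upper) auto
  then have "cmod (A_inner A (T (?c *\<^sub>C x)) (?c *\<^sub>C x)) \<le> w"
    using w(2) by simp
  moreover have "cmod (A_inner A (T (?c *\<^sub>C x)) (?c *\<^sub>C x))
      = cmod (A_inner A (T x) x) / (A_norm A x)\<^sup>2"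
    using pos by (simp add: bounded_clinearD[OF T] A_inner_linear norm_mult norm_divide
        power2_eq_square)
  ultimately have "cmod (A_inner A (T x) x) / (A_norm A x)\<^sup>2 \<le> w" by simp
  then show ?thesis using pos by (simp add: divide_le_eq)
qed

text \<open>The quadratic form of the antidiagonal block operator with both entries \<open>T\<close>. By polarization
  it is half the difference of the forms of \<open>T\<close> at \<open>x + z\<close> and at \<open>x - z\<close>, and the parallelogram
  law adds up the two bounds.\<close>

lemma A_inner_swap_le:
  assumes T: "bounded_clinear T" and w: "A_numerical_radius A T = ennreal w" "w \<ge> 0"
  shows "cmod (A_inner A (T z) x + A_inner A (T x) z) \<le> w * ((A_norm A x)\<^sup>2 + (A_norm A z)\<^sup>2)"
proof -
  have "2 * (A_inner A (T z) x + A_inner A (T x) z)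
      = A_inner A (T (x + z)) (x + z) - A_inner A (T (x - z)) (x - z)"
    by (simp add: bounded_clinearD[OF T] A_inner_linear)
  then have "2 * cmod (A_inner A (T z) x + A_inner A (T x) z)
      = cmod (A_inner A (T (x + z)) (x + z) - A_inner A (T (x - z)) (x - z))"
    by (metis norm_mult norm_numeral)
  also have "\<dots> \<le> w * (A_norm A (x + z))\<^sup>2 + w * (A_norm A (x - z))\<^sup>2"
    by (intro order_trans[OF norm_triangle_ineq4] add_mono A_inner_image_le[OF T w])
  also have "\<dots> = 2 * (w * ((A_norm A x)\<^sup>2 + (A_norm A z)\<^sup>2))"
    by (simp only: distrib_left[symmetric] A_norm_parallelogram)
  finally show ?thesis by simp
qed

end

section \<open>The block operator\<close>

theorem proposition4p3:
  fixes A T1 T2 T3 :: "'a::chilbert_space \<Rightarrow> 'a"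
  assumes "positive_op A"
    and "T1 \<in> A_adjointable A" and "T2 \<in> A_adjointable A" and "T3 \<in> A_adjointable A"
  shows "A_numerical_radius (diag_op3 A)
      (block_op3
        T1 T2 T3
        T2 T3 (\<lambda>x. \<i> *\<^sub>C T1 x)
        T3 (\<lambda>x. \<i> *\<^sub>C T1 x) (\<lambda>x. \<i> *\<^sub>C T2 x))
    \<le> A_numerical_radius A T3
      + max (A_numerical_radius A T1) (A_numerical_radius A T2)
      + ennreal (sqrt 2) *
        (A_op_seminorm A (\<lambda>x. T1 x - T2 x) + A_op_seminorm A (\<lambda>x. T1 x + T2 x))"
    (is "?lhs \<le> ?rhs")
proof (cases "?rhs = \<infinity>")
  case True
  show ?thesis unfolding True by simp
next
  case False
  interpret positive_operator A by standard (rule assms(1))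
  have T: "bounded_clinear T1" "bounded_clinear T2" "bounded_clinear T3"
    using assms(2-4) by (simp_all add: A_adjointable_def)
  let ?M = "\<lambda>x. T1 x - T2 x" and ?P = "\<lambda>x. T1 x + T2 x"
  have MP: "bounded_clinear ?M" "bounded_clinear ?P"
    using T by (simp_all add: bounded_clinear_def scaleC_add_right scaleC_diff_right
        bounded_linear_sub bounded_linear_add)
  have ker: "A (?M x) = 0" "A (?P x) = 0" if "A x = 0" for x
    using A_adjointable_ker[OF assms(2) that] A_adjointable_ker[OF assms(3) that]
    by (simp_all add: A_linear)
  have fin: "A_numerical_radius A T3 \<noteq> \<infinity>" "A_numerical_radius A T1 \<noteq> \<infinity>"
      "A_numerical_radius A T2 \<noteq> \<infinity>" "A_op_seminorm A ?M \<noteq> \<infinity>" "A_op_seminorm A ?P \<noteq> \<infinity>"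
    using False by (auto simp: ennreal_mult_eq_top_iff max_def top_unique split: if_splits)
  obtain w1 where w1: "A_numerical_radius A T1 = ennreal w1" "w1 \<ge> 0"
    using fin(2) ennreal_cases by (metis infinity_ennreal_def)
  obtain w2 where w2: "A_numerical_radius A T2 = ennreal w2" "w2 \<ge> 0"
    using fin(3) ennreal_cases by (metis infinity_ennreal_def)
  obtain w3 where w3: "A_numerical_radius A T3 = ennreal w3" "w3 \<ge> 0"
    using fin(1) ennreal_cases by (metis infinity_ennreal_def)
  obtain m where m: "A_op_seminorm A ?M = ennreal m" "m \<ge> 0"
    using fin(4) ennreal_cases by (metis infinity_ennreal_def)
  obtain p where p: "A_op_seminorm A ?P = ennreal p" "p \<ge> 0"
    using fin(5) ennreal_cases by (metis infinity_ennreal_def)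
  let ?n = "A_norm A"
  have MPle: "cmod (A_inner A (?M u) v) \<le> m * ?n u * ?n v"
    "cmod (A_inner A (?P u) v) \<le> p * ?n u * ?n v" for u v
    using A_norm_image_le[OF MP(1) ker(1) m, of u] A_norm_image_le[OF MP(2) ker(2) p, of u]
      A_Cauchy_Schwarz[of "?M u" v] A_Cauchy_Schwarz[of "?P u" v]
    by (meson A_norm_nonneg mult_right_mono order_trans)+
  have off1: "2 * cmod (A_inner A (T1 u) v) \<le> (m + p) * (?n u * ?n v)" for u v
  proof -
    have "2 * A_inner A (T1 u) v = A_inner A (?P u) v + A_inner A (?M u) v"
      by (simp add: A_inner_linear)
    then have "2 * cmod (A_inner A (T1 u) v) = cmod (A_inner A (?P u) v + A_inner A (?M u) v)"
      by (metis norm_mult norm_numeral)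
    also have "\<dots> \<le> p * ?n u * ?n v + m * ?n u * ?n v"
      by (intro order_trans[OF norm_triangle_ineq] add_mono MPle)
    finally show ?thesis by (simp add: algebra_simps)
  qed
  have off2: "2 * cmod (A_inner A (T2 u) v) \<le> (m + p) * (?n u * ?n v)" for u v
  proof -
    have "2 * A_inner A (T2 u) v = A_inner A (?P u) v - A_inner A (?M u) v"
      by (simp add: A_inner_linear)
    then have "2 * cmod (A_inner A (T2 u) v) = cmod (A_inner A (?P u) v - A_inner A (?M u) v)"
      by (metis norm_mult norm_numeral)
    also have "\<dots> \<le> p * ?n u * ?n v + m * ?n u * ?n v"
      by (intro order_trans[OF norm_triangle_ineq4] add_mono MPle)
    finally show ?thesis by (simp add: algebra_simps)
  qed
  have rhs: "?rhs = ennreal (w3 + max w1 w2 + sqrt 2 * (m + p))"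
  proof -
    have "max (ennreal w1) (ennreal w2) = ennreal (max w1 w2)"
      using w1(2) w2(2) by (simp add: max_def)
    then show ?thesis
      unfolding w1(1) w2(1) w3(1) m(1) p(1)
      using w1(2) w2(2) w3(2) m(2) p(2) by (simp add: ennreal_plus ennreal_mult)
  qed
  show ?thesis
    unfolding rhs A_numerical_radius_def[of "diag_op3 A"]
  proof (intro SUP_least ennreal_leI, clarify)
    fix x y z :: 'a
    assume "A_norm (diag_op3 A) (x, y, z) = 1"
    then have "1 = Re (A_inner A x x) + Re (A_inner A y y) + Re (A_inner A z z)"
      by (simp add: A_norm_def A_inner_def diag_op3_def block_op3_def cinner_prod_def)
    then have one: "(?n x)\<^sup>2 + (?n y)\<^sup>2 + (?n z)\<^sup>2 = 1"
      by (simp add: A_norm_sq)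
    let ?i = "A_inner A"
    \<comment> \<open>The antidiagonal part, the rest of the diagonal, and the four remaining entries.\<close>
    define q3 where "q3 = (?i (T3 z) x + ?i (T3 x) z) + ?i (T3 y) y"
    define q0 where "q0 = ?i (T1 x) x + \<i> * ?i (T2 z) z"
    define q1 where "q1 = (?i (T2 y) x + ?i (T2 x) y) + \<i> * (?i (T1 z) y + ?i (T1 y) z)"
    have Q: "A_inner (diag_op3 A) (block_op3 T1 T2 T3 T2 T3 (\<lambda>x. \<i> *\<^sub>C T1 x)
        T3 (\<lambda>x. \<i> *\<^sub>C T1 x) (\<lambda>x. \<i> *\<^sub>C T2 x) (x, y, z)) (x, y, z) = q3 + q0 + q1"
      by (simp add: q3_def q0_def q1_def A_inner_def diag_op3_def block_op3_def cinner_prod_def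
          A_linear cinner_add_left cinner_scaleC_left algebra_simps)
    have "cmod q3 \<le> w3 * ((?n x)\<^sup>2 + (?n z)\<^sup>2) + w3 * (?n y)\<^sup>2"
      unfolding q3_def
      by (intro order_trans[OF norm_triangle_ineq] add_mono A_inner_swap_le[OF T(3) w3]
          A_inner_image_le[OF T(3) w3])
    also have "\<dots> = w3 * ((?n x)\<^sup>2 + (?n y)\<^sup>2 + (?n z)\<^sup>2)" by (simp add: algebra_simps)
    finally have q3: "cmod q3 \<le> w3" by (simp add: one)
    have "cmod q0 \<le> w1 * (?n x)\<^sup>2 + w2 * (?n z)\<^sup>2"
      unfolding q0_def using A_inner_image_le[OF T(1) w1, of x] A_inner_image_le[OF T(2) w2, of z]
      by (intro order_trans[OF norm_triangle_ineq] add_mono) (simp_all add: norm_mult)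
    also have "\<dots> \<le> max w1 w2 * (?n x)\<^sup>2 + max w1 w2 * (?n z)\<^sup>2"
      by (intro add_mono mult_right_mono) auto
    also have "\<dots> = max w1 w2 * ((?n x)\<^sup>2 + (?n z)\<^sup>2)" by (simp add: algebra_simps)
    also have "\<dots> \<le> max w1 w2 * 1"
      using one w1(2) by (intro mult_left_mono) (smt (verit) zero_le_power2)+
    finally have q0: "cmod q0 \<le> max w1 w2" by simp
    have "cmod q1 \<le> (cmod (?i (T2 y) x) + cmod (?i (T2 x) y))
        + (cmod (?i (T1 z) y) + cmod (?i (T1 y) z))"
      unfolding q1_def
      by (intro order_trans[OF norm_triangle_ineq] add_mono)
        (simp_all add: norm_mult norm_triangle_ineq)
    also have "\<dots> \<le> (m + p) * (?n x * ?n y) + (m + p) * (?n y * ?n z)"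
      using off2[of y x] off2[of x y] off1[of z y] off1[of y z]
      by (simp add: mult.commute[of "?n y" "?n x"] mult.commute[of "?n z" "?n y"])
    also have "\<dots> = (m + p) * (?n x * ?n y + ?n y * ?n z)" by (simp add: distrib_left)
    also have "\<dots> \<le> (m + p) * 1"
    proof (intro mult_left_mono)
      show "?n x * ?n y + ?n y * ?n z \<le> 1"
        using one sum_squares_bound[of "?n x" "?n y"] sum_squares_bound[of "?n y" "?n z"]
          zero_le_power2[of "?n x"] zero_le_power2[of "?n z"] by argo
    qed (use m p in simp)
    also have "\<dots> \<le> sqrt 2 * (m + p)"
      using m p mult_right_mono[of 1 "sqrt 2" "m + p"] by simp
    finally have q1: "cmod q1 \<le> sqrt 2 * (m + p)" .
    have "cmod (q3 + q0 + q1) \<le> cmod q3 + cmod q0 + cmod q1"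
      by (intro order_trans[OF norm_triangle_ineq] add_mono norm_triangle_ineq order_refl)
    also have "\<dots> \<le> w3 + max w1 w2 + sqrt 2 * (m + p)" using q3 q0 q1 by simp
    finally show "cmod (A_inner (diag_op3 A) (block_op3 T1 T2 T3 T2 T3 (\<lambda>x. \<i> *\<^sub>C T1 x)
        T3 (\<lambda>x. \<i> *\<^sub>C T1 x) (\<lambda>x. \<i> *\<^sub>C T2 x) (x, y, z)) (x, y, z))
        \<le> w3 + max w1 w2 + sqrt 2 * (m + p)"
      unfolding Q .
  qed
qed

end
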